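(* Let $D$ be a loose $k$-partite tournament ($k\ge3$), let $X_1$ be a partite set of $D$ that is not $\{1,2\}$-competing, and let $X_2,\dots,X_k$ be the remaining partite sets, labeled so that: for every anti-$\{1,2\}$-competing set $S\subseteq X_1$ containing at least two non-sink vertices, every non-sink vertex of $S$ has all of its out-neighbors in $X_2$. For $2\le i\le k$ let $F_i=\{v\in V(D): \emptyset\ne N^+(v)\subseteq X_i\}$. Then: (1) $F_i\subseteq X_1$ for every $2\le i\le k$; (2) $\bigcup_{i=3}^k X_i$ is a clique in $C_{1,2}(D)$, and every vertex of $\bigcup_{i=3}^k X_i$ is adjacent in $C_{1,2}(D)$ to every vertex of $X_2$; (3) for distinct $i,j\in\{2,\dots,k\}$, every vertex of $F_i$ is adjacent in $C_{1,2}(D)$ to every vertex of $F_j\cup X_j$; (4) for $i\in\{2,\dots,k\}$, a non-sink vertex $x$ with $N^+(x)\subseteq X_i$, and a vertex $y\in X_i$: $x$ and $y$ are not adjacent in $C_{1,2}(D)$ if and only if $N^+(x)=\{y\}$ or $N^+(y)=\{x\}$; (5) if $D$ has a sink or $X_1$ contains an anti-$\{1,2\}$-competing set of size at least three, then $V(D)\setminus X_1$ is a clique in $C_{1,2}(D)$.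
   Context: All graphs and digraphs are finite and simple. For a digraph $D$ and a vertex $v$, $N^+(v)$ is the out-neighborhood of $v$; a sink is a vertex of outdegree $0$. $d_D(x,y)$ is the length of a shortest directed path from $x$ to $y$ in $D$. The $(1,2)$-step competition graph $C_{1,2}(D)$ is the graph on $V(D)$ in which distinct $u,v$ are adjacent iff there is a vertex $w\notin\{u,v\}$ with either $d_{D-v}(u,w)\le 1$ and $d_{D-u}(v,w)\le 2$, or $d_{D-u}(v,w)\le 1$ and $d_{D-v}(u,w)\le 2$. A $k$-partite tournament is an orientation of a complete $k$-partite graph (with $k$ nonempty partite sets); a multipartite tournament is one with $k\ge 3$. A set of vertices is $\{1,2\}$-competing if it is a clique in $C_{1,2}(D)$, anti-$\{1,2\}$-competing if it is a stable set in $C_{1,2}(D)$. A multipartite tournament is loose if some partite set is not $\{1,2\}$-competing. *)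

theory Defs
  imports "Graph_Theory.Graph_Theory"
begin

definition out_nbrs :: "('a, 'b) pre_digraph \<Rightarrow> 'a \<Rightarrow> 'a set" where
  "out_nbrs D v = {w. v \<rightarrow>\<^bsub>D\<^esub> w}"

definition sink :: "('a, 'b) pre_digraph \<Rightarrow> 'a \<Rightarrow> bool" where
  "sink D v \<longleftrightarrow> v \<in> verts D \<and> out_degree D v = 0"

definition ddist :: "('a, 'b) pre_digraph \<Rightarrow> 'a \<Rightarrow> 'a \<Rightarrow> ereal" where
  "ddist D x y = wf_digraph.\<mu> D (\<lambda>_. 1) x y"

text \<open>
  As in \<^theory>\<open>Graph_Theory.Digraph\<close>, an undirected simple graph is a loop-free symmetric
  digraph; here its arcs are pairs of vertices.
\<close>

definition C12 :: "('a, 'b) pre_digraph \<Rightarrow> 'a pair_pre_digraph" where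
  "C12 D = \<lparr> pverts = verts D,
     parcs = {(u, v). u \<in> verts D \<and> v \<in> verts D \<and> u \<noteq> v \<and>
       (\<exists>w \<in> verts D - {u, v}.
          ddist (pre_digraph.del_vert D v) u w \<le> 1 \<and> ddist (pre_digraph.del_vert D u) v w \<le> 2 \<or>
          ddist (pre_digraph.del_vert D u) v w \<le> 1 \<and> ddist (pre_digraph.del_vert D v) u w \<le> 2)} \<rparr>"

definition clique :: "('a, 'b) pre_digraph \<Rightarrow> 'a set \<Rightarrow> bool" where
  "clique G K \<longleftrightarrow> K \<subseteq> verts G \<and> (\<forall>u \<in> K. \<forall>v \<in> K. u \<noteq> v \<longrightarrow> u \<rightarrow>\<^bsub>G\<^esub> v)"

definition stable_set :: "('a, 'b) pre_digraph \<Rightarrow> 'a set \<Rightarrow> bool" where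
  "stable_set G S \<longleftrightarrow> S \<subseteq> verts G \<and> (\<forall>u \<in> S. \<forall>v \<in> S. \<not> u \<rightarrow>\<^bsub>G\<^esub> v)"

definition competing12 :: "('a, 'b) pre_digraph \<Rightarrow> 'a set \<Rightarrow> bool" where
  "competing12 D S \<longleftrightarrow> clique (C12 D) S"

definition anti_competing12 :: "('a, 'b) pre_digraph \<Rightarrow> 'a set \<Rightarrow> bool" where
  "anti_competing12 D S \<longleftrightarrow> stable_set (C12 D) S"

definition complete_partite :: "nat \<Rightarrow> (nat \<Rightarrow> 'a set) \<Rightarrow> 'a pair_pre_digraph" where
  "complete_partite k X = \<lparr> pverts = (\<Union>i\<in>{1..k}. X i),
     parcs = {(u, v). \<exists>i\<in>{1..k}. \<exists>j\<in>{1..k}. i \<noteq> j \<and> u \<in> X i \<and> v \<in> X j} \<rparr>"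

definition orientation_of :: "('a, 'b) pre_digraph \<Rightarrow> ('a, 'c) pre_digraph \<Rightarrow> bool" where
  "orientation_of D G \<longleftrightarrow> digraph D \<and> verts D = verts G \<and>
     (\<forall>u v. u \<rightarrow>\<^bsub>D\<^esub> v \<longrightarrow> u \<rightarrow>\<^bsub>G\<^esub> v) \<and>
     (\<forall>u v. u \<rightarrow>\<^bsub>G\<^esub> v \<longrightarrow> (u \<rightarrow>\<^bsub>D\<^esub> v) \<noteq> (v \<rightarrow>\<^bsub>D\<^esub> u))"

text \<open>The partite sets are \<open>X 1, \<dots>, X k\<close>; the values of \<open>X\<close> at other indices play no role.\<close>

definition partite_tournament :: "nat \<Rightarrow> (nat \<Rightarrow> 'a set) \<Rightarrow> ('a, 'b) pre_digraph \<Rightarrow> bool" where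
  "partite_tournament k X D \<longleftrightarrow>
     (\<forall>i\<in>{1..k}. X i \<noteq> {}) \<and> disjoint_family_on X {1..k} \<and>
     orientation_of D (complete_partite k X)"

definition multipartite_tournament :: "nat \<Rightarrow> (nat \<Rightarrow> 'a set) \<Rightarrow> ('a, 'b) pre_digraph \<Rightarrow> bool" where
  "multipartite_tournament k X D \<longleftrightarrow> k \<ge> 3 \<and> partite_tournament k X D"

definition loose :: "nat \<Rightarrow> (nat \<Rightarrow> 'a set) \<Rightarrow> ('a, 'b) pre_digraph \<Rightarrow> bool" where
  "loose k X D \<longleftrightarrow> multipartite_tournament k X D \<and> (\<exists>i\<in>{1..k}. \<not> competing12 D (X i))"

definition F_set :: "('a, 'b) pre_digraph \<Rightarrow> 'a set \<Rightarrow> 'a set" where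
  "F_set D A = {v \<in> verts D. out_nbrs D v \<noteq> {} \<and> out_nbrs D v \<subseteq> A}"

lemma pair_graph_C12:
  assumes "digraph D"
  shows "pair_graph (C12 D)"
proof -
  interpret D: digraph D by (rule assms)
  have "finite (parcs (C12 D))"
    by (rule finite_subset[of _ "verts D \<times> verts D"]) (auto simp: C12_def)
  then show ?thesis
    by unfold_locales (auto simp: C12_def symmetric_def sym_def arcs_ends_conv insert_commute)
qed

text \<open>
  \<open>\<mu>\<close> is an infimum over walks; with unit costs it is attained by a path, so \<open>ddist\<close> is the
  length of a shortest directed path.
\<close>

lemma ddist_le_iff:
  assumes "digraph D"
  shows "ddist D x y \<le> ereal (real n) \<longleftrightarrow> (\<exists>p. pre_digraph.apath D x p y \<and> length p \<le> n)"
proof -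
  interpret D: digraph D by (rule assms)
  have cost: "D.awalk_cost (\<lambda>_. 1) p = real (length p)" for p :: "'b list"
    by (induct p) auto
  show ?thesis
  proof
    assume le: "ddist D x y \<le> ereal (real n)"
    have "x \<rightarrow>\<^sup>*\<^bsub>D\<^esub> y"
      using le D.shortest_path_inf[of x y "\<lambda>_. 1"] unfolding ddist_def by fastforce
    then obtain p where "D.apath x p y" "D.\<mu> (\<lambda>_. 1) x y = ereal (D.awalk_cost (\<lambda>_. 1) p)"
      using D.min_cost_awalk[of x y "\<lambda>_. 1"] by auto
    then show "\<exists>p. D.apath x p y \<and> length p \<le> n"
      using le by (auto simp: ddist_def cost)
  next
    assume "\<exists>p. D.apath x p y \<and> length p \<le> n"
    then obtain p where p: "D.apath x p y" "length p \<le> n" by auto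
    have "D.\<mu> (\<lambda>_. 1) x y \<le> ereal (D.awalk_cost (\<lambda>_. 1) p)"
      using p by (intro D.min_cost_le_walk_cost D.awalkI_apath)
    also have "\<dots> \<le> ereal (real n)" using p(2) by (simp add: cost)
    finally show "ddist D x y \<le> ereal (real n)" by (simp add: ddist_def)
  qed
qed

end

theory Submission
  imports Defs
begin

text \<open>
  Two non-adjacent vertices of \<open>X 1\<close> have disjoint out-neighborhoods, and by the labeling both
  lie in \<open>X 2\<close> unless one of the two vertices is a sink. This yields \<open>p, q \<in> X 1\<close> (with
  \<open>p = q\<close> in the presence of a sink) such that every vertex outside \<open>X 1\<close> dominates \<open>p\<close> or \<open>q\<close>, and
  every vertex outside \<open>X 1 \<union> X 2\<close> dominates both. Hence two vertices from different partite
  sets other than \<open>X 1\<close> have a common out-neighbor in \<open>X 1\<close>.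
\<close>

section \<open>Distances one and two as arcs and two-arc paths\<close>

lemma (in digraph) digraph_del_vert: "digraph (del_vert u)"
proof -
  interpret H: fin_digraph "del_vert u" by (rule fin_digraph_del_vert)
  show ?thesis
    by unfold_locales (auto simp: del_vert_simps ends_del_vert no_loops no_multi_arcs)
qed

lemma (in digraph) dominates_del_vert_iff:
  "x \<rightarrow>\<^bsub>del_vert u\<^esub> y \<longleftrightarrow> x \<rightarrow> y \<and> x \<noteq> u \<and> y \<noteq> u"
  by (auto simp: arcs_ends_conv del_vert_simps)

text \<open>Distinct ends exclude the empty path, so a path of length at most one is a single
  arc.\<close>

lemma (in digraph) ddist_le_1_iff:
  assumes "x \<noteq> y"
  shows "ddist G x y \<le> 1 \<longleftrightarrow> x \<rightarrow> y"
proof -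
  have "ddist G x y \<le> 1 \<longleftrightarrow> (\<exists>p. apath x p y \<and> length p \<le> 1)"
    using ddist_le_iff[OF digraph_axioms, of x y 1] by (simp add: one_ereal_def)
  also have "\<dots> \<longleftrightarrow> (\<exists>e. apath x [e] y)"
    using assms by (auto simp: le_Suc_eq length_Suc_conv apath_Nil_iff)
  also have "\<dots> \<longleftrightarrow> x \<rightarrow> y"
    using assms by (auto simp: apath_simps arcs_ends_conv)
  finally show ?thesis .
qed

lemma (in digraph) ddist_le_2_iff:
  assumes "x \<noteq> y"
  shows "ddist G x y \<le> 2 \<longleftrightarrow> x \<rightarrow> y \<or> (\<exists>z. x \<rightarrow> z \<and> z \<rightarrow> y)"
proof -
  have "ddist G x y \<le> 2 \<longleftrightarrow> (\<exists>p. apath x p y \<and> length p \<le> 2)"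
    using ddist_le_iff[OF digraph_axioms, of x y 2] by simp
  also have "\<dots> \<longleftrightarrow> (\<exists>e. apath x [e] y) \<or> (\<exists>e f. apath x [e, f] y)"
  proof
    assume "\<exists>p. apath x p y \<and> length p \<le> 2"
    then obtain p where p: "apath x p y" "length p \<le> 2" by blast
    then have "p \<noteq> []" using assms by (auto simp: apath_Nil_iff)
    with p(2) have "(\<exists>e. p = [e]) \<or> (\<exists>e f. p = [e, f])"
      by (cases p; cases "tl p") auto
    with p(1) show "(\<exists>e. apath x [e] y) \<or> (\<exists>e f. apath x [e, f] y)" by blast
  next
    assume "(\<exists>e. apath x [e] y) \<or> (\<exists>e f. apath x [e, f] y)"
    then show "\<exists>p. apath x p y \<and> length p \<le> 2"
      by (metis One_nat_def Suc_1 le_Suc_eq length_Cons list.size(3) order_refl)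
  qed
  also have "\<dots> \<longleftrightarrow> x \<rightarrow> y \<or> (\<exists>z. x \<rightarrow> z \<and> z \<rightarrow> y)"
  proof -
    have "(\<exists>e. apath x [e] y) \<longleftrightarrow> x \<rightarrow> y"
      using assms by (auto simp: apath_simps arcs_ends_conv)
    moreover have "(\<exists>e f. apath x [e, f] y) \<longleftrightarrow> (\<exists>z. x \<rightarrow> z \<and> z \<rightarrow> y)"
    proof
      assume "\<exists>e f. apath x [e, f] y"
      then show "\<exists>z. x \<rightarrow> z \<and> z \<rightarrow> y"
        by (auto simp: apath_simps arcs_ends_conv image_iff)
    next
      assume "\<exists>z. x \<rightarrow> z \<and> z \<rightarrow> y"
      then obtain e f where "e \<in> arcs G" "f \<in> arcs G" "tail G e = x" "head G e = tail G f" "head G f = y"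
        by (auto simp: arcs_ends_conv)
      \<comment> \<open>A path needs its three vertices distinct: the middle one differs from both
        ends because there are no loops, and the ends differ by assumption.\<close>
      then have "apath x [e, f] y"
        using assms no_loops[of e] no_loops[of f] by (auto simp: apath_simps)
      then show "\<exists>e f. apath x [e, f] y" by blast
    qed
    ultimately show ?thesis by simp
  qed
  finally show ?thesis .
qed

section \<open>Adjacency in the competition graph without distances\<close>

definition step12 :: "('a, 'b) pre_digraph \<Rightarrow> 'a \<Rightarrow> 'a \<Rightarrow> 'a \<Rightarrow> bool" where
  "step12 D u v w \<longleftrightarrow> u \<rightarrow>\<^bsub>D\<^esub> w \<and> (v \<rightarrow>\<^bsub>D\<^esub> w \<or> (\<exists>z. z \<noteq> u \<and> v \<rightarrow>\<^bsub>D\<^esub> z \<and> z \<rightarrow>\<^bsub>D\<^esub> w))"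

lemma (in digraph) C12_adj_iff:
  "u \<rightarrow>\<^bsub>C12 G\<^esub> v \<longleftrightarrow> u \<noteq> v \<and> (\<exists>w. w \<noteq> u \<and> w \<noteq> v \<and> (step12 G u v w \<or> step12 G v u w))"
proof -
  have one: "ddist (del_vert b) a w \<le> 1 \<longleftrightarrow> a \<rightarrow> w" if "w \<noteq> a" "w \<noteq> b" "a \<noteq> b" for a b w
    using digraph.ddist_le_1_iff[OF digraph_del_vert, of a w b] that
    by (simp add: dominates_del_vert_iff)
  have two: "ddist (del_vert b) a w \<le> 2 \<longleftrightarrow> a \<rightarrow> w \<or> (\<exists>z. z \<noteq> b \<and> a \<rightarrow> z \<and> z \<rightarrow> w)"
    if "w \<noteq> a" "w \<noteq> b" "a \<noteq> b" for a b w
    using digraph.ddist_le_2_iff[OF digraph_del_vert, of a w b] that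
    by (auto simp: dominates_del_vert_iff)
  have "u \<rightarrow>\<^bsub>C12 G\<^esub> v \<longleftrightarrow> u \<in> verts G \<and> v \<in> verts G \<and> u \<noteq> v \<and>
       (\<exists>w \<in> verts G - {u, v}.
          ddist (del_vert v) u w \<le> 1 \<and> ddist (del_vert u) v w \<le> 2 \<or>
          ddist (del_vert u) v w \<le> 1 \<and> ddist (del_vert v) u w \<le> 2)"
    by (simp add: C12_def arcs_ends_conv)
  also have "\<dots> \<longleftrightarrow> u \<in> verts G \<and> v \<in> verts G \<and> u \<noteq> v \<and>
       (\<exists>w \<in> verts G - {u, v}. step12 G u v w \<or> step12 G v u w)"
  proof (intro conj_cong bex_cong refl)
    fix w assume "u \<noteq> v" "w \<in> verts G - {u, v}"
    then show "(ddist (del_vert v) u w \<le> 1 \<and> ddist (del_vert u) v w \<le> 2 \<or>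
        ddist (del_vert u) v w \<le> 1 \<and> ddist (del_vert v) u w \<le> 2) \<longleftrightarrow>
        step12 G u v w \<or> step12 G v u w"
      using one[of w u v] two[of w u v] one[of w v u] two[of w v u]
      unfolding step12_def by blast
  qed
  also have "\<dots> \<longleftrightarrow> u \<noteq> v \<and> (\<exists>w. w \<noteq> u \<and> w \<noteq> v \<and> (step12 G u v w \<or> step12 G v u w))"
    unfolding step12_def by (auto dest: adj_in_verts)
  finally show ?thesis .
qed

lemma verts_C12: "verts (C12 D) = verts D"
  by (simp add: C12_def)

lemma C12_adj_sym:
  assumes "digraph D" and "u \<rightarrow>\<^bsub>C12 D\<^esub> v"
  shows "v \<rightarrow>\<^bsub>C12 D\<^esub> u"
  using assms(2) unfolding digraph.C12_adj_iff[OF assms(1)] by blast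

text \<open>This is the case where both distances are one; the absence of loops makes the common
  out-neighbor differ from \<open>u\<close> and \<open>v\<close>.\<close>

lemma C12_adj_common:
  assumes "digraph D" "u \<noteq> v" "u \<rightarrow>\<^bsub>D\<^esub> w" "v \<rightarrow>\<^bsub>D\<^esub> w"
  shows "u \<rightarrow>\<^bsub>C12 D\<^esub> v"
proof -
  interpret D: digraph D by (rule assms(1))
  have "w \<noteq> u" "w \<noteq> v" using assms D.adj_not_same by auto
  then show ?thesis using assms unfolding D.C12_adj_iff step12_def by blast
qed

text \<open>Here \<open>u\<close> reaches \<open>w\<close> in one step and \<open>v\<close> reaches
  it through \<open>z\<close>. Loop-freeness gives \<open>w \<noteq> u\<close>, but
  \<open>w \<noteq> v\<close> is assumed because a general digraph may contain both
  \<open>v \<rightarrow> z\<close> and \<open>z \<rightarrow> v\<close>.\<close>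

lemma C12_adj_two_step:
  assumes "digraph D" "u \<noteq> v" "u \<rightarrow>\<^bsub>D\<^esub> w" "v \<rightarrow>\<^bsub>D\<^esub> z" "z \<rightarrow>\<^bsub>D\<^esub> w" "z \<noteq> u" "w \<noteq> v"
  shows "u \<rightarrow>\<^bsub>C12 D\<^esub> v"
proof -
  interpret D: digraph D by (rule assms(1))
  have "w \<noteq> u" using assms D.adj_not_same by auto
  then show ?thesis using assms unfolding D.C12_adj_iff step12_def by blast
qed

text \<open>To compete with \<open>y\<close>, the vertex \<open>x\<close> must leave along an arc
  that avoids \<open>y\<close>, and it has none.\<close>

lemma not_C12_adj_if_single_out_nbr:
  assumes "digraph D" "out_nbrs D x = {y}"
  shows "\<not> x \<rightarrow>\<^bsub>C12 D\<^esub> y"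
  using assms(2) unfolding digraph.C12_adj_iff[OF assms(1)] step12_def out_nbrs_def by blast

lemma (in digraph) sink_iff: "sink G v \<longleftrightarrow> v \<in> verts G \<and> out_nbrs G v = {}"
proof -
  have "out_degree G v = 0 \<longleftrightarrow> out_arcs G v = {}"
    unfolding out_degree_def using finite_arcs by (simp add: out_arcs_def)
  also have "\<dots> \<longleftrightarrow> out_nbrs G v = {}"
    by (auto simp: out_nbrs_def arcs_ends_conv out_arcs_def)
  finally show ?thesis by (auto simp: sink_def)
qed

section \<open>Arcs between partite sets\<close>

locale partite_tournament_digraph = digraph D for D :: "('a, 'b) pre_digraph" +
  fixes k :: nat and X :: "nat \<Rightarrow> 'a set"
  assumes partite_tournament: "partite_tournament k X D"
begin

lemma disjoint_parts:
  "i \<in> {1..k} \<Longrightarrow> j \<in> {1..k} \<Longrightarrow> v \<in> X i \<Longrightarrow> v \<in> X j \<Longrightarrow> i = j"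
  using partite_tournament unfolding partite_tournament_def disjoint_family_on_def by blast

lemma verts_eq: "verts D = (\<Union>i\<in>{1..k}. X i)"
  using partite_tournament
  by (simp add: partite_tournament_def orientation_of_def complete_partite_def)

lemma complete_partite_adj_iff:
  "u \<rightarrow>\<^bsub>complete_partite k X\<^esub> v \<longleftrightarrow>
    (\<exists>i\<in>{1..k}. \<exists>j\<in>{1..k}. i \<noteq> j \<and> u \<in> X i \<and> v \<in> X j)"
  by (simp add: complete_partite_def arcs_ends_conv)

lemma adj_imp_complete_partite_adj: "u \<rightarrow>\<^bsub>D\<^esub> v \<Longrightarrow> u \<rightarrow>\<^bsub>complete_partite k X\<^esub> v"
  using partite_tournament unfolding partite_tournament_def orientation_of_def by blast

lemma complete_partite_adj_imp:
  "u \<rightarrow>\<^bsub>complete_partite k X\<^esub> v \<Longrightarrow> (u \<rightarrow>\<^bsub>D\<^esub> v) \<noteq> (v \<rightarrow>\<^bsub>D\<^esub> u)"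
  using partite_tournament unfolding partite_tournament_def orientation_of_def by blast

text \<open>The \<open>\<noteq>\<close> between truth values in \<open>orientation_of\<close> is an
  exclusive or, so two opposite arcs cannot coexist.\<close>

lemma adj_asym: "u \<rightarrow>\<^bsub>D\<^esub> v \<Longrightarrow> \<not> v \<rightarrow>\<^bsub>D\<^esub> u"
  using adj_imp_complete_partite_adj complete_partite_adj_imp by blast

lemma adj_total:
  "i \<in> {1..k} \<Longrightarrow> j \<in> {1..k} \<Longrightarrow> i \<noteq> j \<Longrightarrow> u \<in> X i \<Longrightarrow> v \<in> X j \<Longrightarrow> \<not> u \<rightarrow>\<^bsub>D\<^esub> v \<Longrightarrow> v \<rightarrow>\<^bsub>D\<^esub> u"
  using complete_partite_adj_imp[of u v] complete_partite_adj_iff[of u v] by blast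

lemma adj_not_same_part: "i \<in> {1..k} \<Longrightarrow> u \<in> X i \<Longrightarrow> u \<rightarrow>\<^bsub>D\<^esub> v \<Longrightarrow> v \<notin> X i"
  using adj_imp_complete_partite_adj[of u v] disjoint_parts
  unfolding complete_partite_adj_iff by blast

text \<open>All vertices of \<open>X i\<close> dominate the sink, which is thus a common
  out-neighbor of any two of them. This confines sinks to a partite set that is not
  competing.\<close>

lemma sink_imp_competing:
  assumes "i \<in> {1..k}" "j \<in> {1..k}" "i \<noteq> j" "sink D s" "s \<in> X j"
  shows "competing12 D (X i)"
proof -
  have "u \<rightarrow>\<^bsub>D\<^esub> s" if "u \<in> X i" for u
    using adj_total[of j i s u] assms that by (auto simp: sink_iff out_nbrs_def)
  then have "u \<rightarrow>\<^bsub>C12 D\<^esub> v" if "u \<in> X i" "v \<in> X i" "u \<noteq> v" for u v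
    using that C12_adj_common[OF digraph_axioms] by blast
  moreover have "X i \<subseteq> verts (C12 D)"
    using assms(1) unfolding verts_C12 verts_eq by blast
  ultimately show ?thesis by (simp add: competing12_def clique_def)
qed

end

section \<open>Sinks and non-adjacent pairs in \<open>X 1\<close>\<close>

locale labeled_loose = partite_tournament_digraph +
  assumes k_ge_3: "k \<ge> 3"
    and not_competing: "\<not> competing12 D (X 1)"
    and labeling: "\<And>S v. \<lbrakk>S \<subseteq> X 1; anti_competing12 D S; card {u \<in> S. \<not> sink D u} \<ge> 2;
           v \<in> S; \<not> sink D v\<rbrakk> \<Longrightarrow> out_nbrs D v \<subseteq> X 2"
begin

text \<open>A sink in any other partite set would make \<open>X 1\<close> competing.\<close>

lemma sink_in_X1:
  assumes "sink D s"
  shows "s \<in> X 1"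
proof -
  obtain j where j: "j \<in> {1..k}" "s \<in> X j"
    using assms by (auto simp: sink_iff verts_eq)
  then show ?thesis
    using sink_imp_competing[of 1 j s] not_competing assms k_ge_3 by fastforce
qed

lemma sink_dominated:
  assumes "sink D s" "v \<in> verts D - X 1"
  shows "v \<rightarrow>\<^bsub>D\<^esub> s"
proof -
  obtain j where "j \<in> {1..k}" "v \<in> X j" using assms by (auto simp: verts_eq)
  then show ?thesis
    using adj_total[of 1 j s v] sink_in_X1 assms k_ge_3 by (force simp: sink_iff out_nbrs_def)
qed

text \<open>The pair \<open>{p, q}\<close> is itself an anti-competing set with two non-sinks, so
  the labeling applies to it.\<close>

lemma nonadjacent_out_nbrs:
  assumes "p \<in> X 1" "q \<in> X 1" "p \<noteq> q" "\<not> p \<rightarrow>\<^bsub>C12 D\<^esub> q" "\<not> sink D p" "\<not> sink D q"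
  shows "out_nbrs D p \<subseteq> X 2" and "out_nbrs D q \<subseteq> X 2"
proof -
  have irrefl: "\<not> u \<rightarrow>\<^bsub>C12 D\<^esub> u" for u unfolding C12_adj_iff by blast
  have "{p, q} \<subseteq> verts D" using assms(1,2) k_ge_3 by (force simp: verts_eq)
  then have "anti_competing12 D {p, q}"
    using assms(4) irrefl C12_adj_sym[OF digraph_axioms, of q p]
    by (auto simp: anti_competing12_def stable_set_def C12_def)
  moreover have "{u \<in> {p, q}. \<not> sink D u} = {p, q}" using assms(5,6) by auto
  then have "card {u \<in> {p, q}. \<not> sink D u} \<ge> 2" using assms(3) by simp
  ultimately show "out_nbrs D p \<subseteq> X 2" "out_nbrs D q \<subseteq> X 2"
    using assms labeling[of "{p, q}"] by auto
qed

text \<open>If both \<open>p\<close> and \<open>q\<close> dominated \<open>v\<close>, it would be a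
  common out-neighbor and make them adjacent; hence at least one of the two arcs points from
  \<open>v\<close> into \<open>X 1\<close>.\<close>

lemma nonadjacent_dominated:
  assumes "p \<in> X 1" "q \<in> X 1" "p \<noteq> q" "\<not> p \<rightarrow>\<^bsub>C12 D\<^esub> q" "v \<in> verts D - X 1"
  shows "v \<rightarrow>\<^bsub>D\<^esub> p \<or> v \<rightarrow>\<^bsub>D\<^esub> q"
proof -
  obtain j where j: "j \<in> {1..k}" "v \<in> X j" "j \<noteq> 1"
    using assms(5) unfolding verts_eq by blast
  have "\<not> (p \<rightarrow>\<^bsub>D\<^esub> v \<and> q \<rightarrow>\<^bsub>D\<^esub> v)"
    using C12_adj_common[OF digraph_axioms] assms(3,4) by blast
  then show ?thesis
    using adj_total[of 1 j p v] adj_total[of 1 j q v] j assms(1,2) k_ge_3 by fastforce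
qed

section \<open>Common out-neighbors in \<open>X 1\<close>\<close>

lemma dominated_pair:
  obtains p q where "p \<in> X 1" "q \<in> X 1"
    "\<And>v. v \<in> verts D - X 1 \<Longrightarrow> v \<rightarrow>\<^bsub>D\<^esub> p \<or> v \<rightarrow>\<^bsub>D\<^esub> q"
    "\<And>i v. i \<in> {3..k} \<Longrightarrow> v \<in> X i \<Longrightarrow> v \<rightarrow>\<^bsub>D\<^esub> p \<and> v \<rightarrow>\<^bsub>D\<^esub> q"
proof (cases "\<exists>s. sink D s")
  case True
  then obtain s where s: "sink D s" by blast
  have "v \<rightarrow>\<^bsub>D\<^esub> s" if "i \<in> {3..k}" "v \<in> X i" for i v
  proof -
    have "v \<in> verts D - X 1"
      using disjoint_parts[of i 1 v] that by (force simp: verts_eq)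
    then show ?thesis using sink_dominated s by blast
  qed
  \<comment> \<open>The two vertices need not be distinct: a sink can serve as both.\<close>
  then show ?thesis using that[of s s] sink_in_X1 sink_dominated s by blast
next
  case False
  have "X 1 \<subseteq> verts (C12 D)" using k_ge_3 unfolding verts_C12 verts_eq by force
  then obtain p q where pq: "p \<in> X 1" "q \<in> X 1" "p \<noteq> q" "\<not> p \<rightarrow>\<^bsub>C12 D\<^esub> q"
    using not_competing by (auto simp: competing12_def clique_def)
  \<comment> \<open>The labeling constrains only non-sinks, which is why the case with a sink is
    treated separately.\<close>
  have sub: "out_nbrs D p \<subseteq> X 2" "out_nbrs D q \<subseteq> X 2"
    using nonadjacent_out_nbrs[OF pq] False by blast+
  have "v \<rightarrow>\<^bsub>D\<^esub> p \<and> v \<rightarrow>\<^bsub>D\<^esub> q" if i: "i \<in> {3..k}" "v \<in> X i" for i v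
  proof -
    have "v \<notin> X 2" using disjoint_parts[of i 2 v] i by force
    then have "\<not> p \<rightarrow>\<^bsub>D\<^esub> v" "\<not> q \<rightarrow>\<^bsub>D\<^esub> v" using sub by (auto simp: out_nbrs_def)
    moreover have "1 \<in> {1..k}" "i \<in> {1..k}" "1 \<noteq> i" using i by auto
    ultimately show ?thesis using adj_total[of 1 i] pq i(2) by blast
  qed
  then show ?thesis using that[of p q] pq nonadjacent_dominated by blast
qed

text \<open>The condition on the indices puts one of \<open>u\<close>, \<open>v\<close> in a partite
  set of index at least three. That vertex dominates both members of the pair from
  \<open>dominated_pair\<close>, and the other vertex dominates at least one of them.\<close>

lemma common_out_nbr:
  assumes "i \<in> {2..k}" "j \<in> {2..k}" "i \<noteq> j \<or> 3 \<le> i" "u \<in> X i" "v \<in> X j"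
  obtains w where "w \<in> X 1" "u \<rightarrow>\<^bsub>D\<^esub> w" "v \<rightarrow>\<^bsub>D\<^esub> w"
proof -
  obtain p q where pq: "p \<in> X 1" "q \<in> X 1"
    "\<And>v. v \<in> verts D - X 1 \<Longrightarrow> v \<rightarrow>\<^bsub>D\<^esub> p \<or> v \<rightarrow>\<^bsub>D\<^esub> q"
    "\<And>i v. i \<in> {3..k} \<Longrightarrow> v \<in> X i \<Longrightarrow> v \<rightarrow>\<^bsub>D\<^esub> p \<and> v \<rightarrow>\<^bsub>D\<^esub> q"
    using dominated_pair by blast
  have "u \<in> verts D - X 1" "v \<in> verts D - X 1"
    using disjoint_parts[of i 1 u] disjoint_parts[of j 1 v] assms by (force simp: verts_eq)+
  moreover have "i \<in> {3..k} \<or> j \<in> {3..k}" using assms by auto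
  ultimately show ?thesis using pq that assms(4,5) by blast
qed

lemma out_nbr_in_X1:
  assumes "v \<in> verts D - X 1"
  obtains w where "w \<in> X 1" "v \<rightarrow>\<^bsub>D\<^esub> w"
  using dominated_pair assms by metis

section \<open>Vertices with all out-neighbors in one partite set\<close>

lemma F_set_subset_X1:
  assumes "i \<in> {2..k}"
  shows "F_set D (X i) \<subseteq> X 1"
proof
  fix v assume v: "v \<in> F_set D (X i)"
  show "v \<in> X 1"
  proof (rule ccontr)
    assume "v \<notin> X 1"
    \<comment> \<open>A vertex outside \<open>X 1\<close> always has an out-neighbor in
      \<open>X 1\<close>, which cannot also lie in \<open>X i\<close>.\<close>
    then obtain w where "w \<in> X 1" "v \<rightarrow>\<^bsub>D\<^esub> w"
      using out_nbr_in_X1[of v] v by (auto simp: F_set_def)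
    then have "w \<in> X 1" "w \<in> X i" using v by (auto simp: F_set_def out_nbrs_def)
    then show False using disjoint_parts[of i 1 w] assms by force
  qed
qed

lemma C12_adj_parts:
  assumes "i \<in> {2..k}" "j \<in> {2..k}" "i \<noteq> j \<or> 3 \<le> i" "u \<in> X i" "v \<in> X j" "u \<noteq> v"
  shows "u \<rightarrow>\<^bsub>C12 D\<^esub> v"
  using common_out_nbr[OF assms(1-5)] C12_adj_common[OF digraph_axioms assms(6)] by metis

text \<open>Out-neighbors \<open>a\<close> of \<open>x\<close> and \<open>b\<close> of
  \<open>y\<close> lie in different partite sets and are joined by an arc. Whichever way it points,
  its head is reached in one step from one of \<open>x\<close>, \<open>y\<close> and in two steps
  from the other.\<close>

lemma C12_adj_F_set_F_set:
  assumes "i \<in> {2..k}" "j \<in> {2..k}" "i \<noteq> j" "x \<in> F_set D (X i)" "y \<in> F_set D (X j)"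
  shows "x \<rightarrow>\<^bsub>C12 D\<^esub> y"
proof -
  obtain a where a: "x \<rightarrow>\<^bsub>D\<^esub> a" "a \<in> X i" using assms(4) by (auto simp: F_set_def out_nbrs_def)
  obtain b where b: "y \<rightarrow>\<^bsub>D\<^esub> b" "b \<in> X j" using assms(5) by (auto simp: F_set_def out_nbrs_def)
  have ij: "i \<in> {1..k}" "j \<in> {1..k}" using assms(1,2) by auto
  have "a \<notin> X j" using disjoint_parts ij a(2) assms(3) by blast
  then have "x \<noteq> y" using a assms(5) by (auto simp: F_set_def out_nbrs_def)
  have x1: "x \<in> X 1" "y \<in> X 1" using F_set_subset_X1 assms by blast+
  have one: "1 \<in> {1..k}" using k_ge_3 by simp
  \<comment> \<open>As out-neighbors of vertices of \<open>X 1\<close>, both \<open>a\<close> and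
    \<open>b\<close> lie outside \<open>X 1\<close>, which contains \<open>x\<close> and
    \<open>y\<close>.\<close>
  have ne: "a \<noteq> y" "b \<noteq> x"
    using adj_not_same_part[OF one] x1 a(1) b(1) by blast+
  show ?thesis
  proof (cases "a \<rightarrow>\<^bsub>D\<^esub> b")
    case True
    then show ?thesis
      using C12_adj_two_step[OF digraph_axioms, of y x b a] \<open>x \<noteq> y\<close> a b ne
        C12_adj_sym[OF digraph_axioms] by metis
  next
    case False
    then have "b \<rightarrow>\<^bsub>D\<^esub> a" using adj_total[OF ij assms(3) a(2) b(2)] by blast
    then show ?thesis
      using C12_adj_two_step[OF digraph_axioms, of x y a b] \<open>x \<noteq> y\<close> a b ne by blast
  qed
qed

text \<open>An out-neighbor \<open>a\<close> of \<open>x\<close> lies in a different partite set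
  from \<open>y\<close>, so \<open>a\<close> and \<open>y\<close> share an out-neighbor
  \<open>w\<close>. Then \<open>y\<close> reaches \<open>w\<close> in one step and \<open>x\<close>
  reaches it through \<open>a\<close>.\<close>

lemma C12_adj_F_set_part:
  assumes "i \<in> {2..k}" "j \<in> {2..k}" "i \<noteq> j" "x \<in> F_set D (X i)" "y \<in> X j"
  shows "x \<rightarrow>\<^bsub>C12 D\<^esub> y"
proof -
  obtain a where a: "x \<rightarrow>\<^bsub>D\<^esub> a" "a \<in> X i" using assms(4) by (auto simp: F_set_def out_nbrs_def)
  obtain w where w: "a \<rightarrow>\<^bsub>D\<^esub> w" "y \<rightarrow>\<^bsub>D\<^esub> w"
    using common_out_nbr[of i j a y] assms a(2) by blast
  have "w \<noteq> x" using w(1) a(1) adj_asym by blast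
  have "x \<in> X 1" using F_set_subset_X1 assms by blast
  then have "x \<noteq> y" using disjoint_parts[of 1 j x] assms by force
  have "a \<noteq> y" using disjoint_parts[of i j a] a(2) assms by force
  have "y \<rightarrow>\<^bsub>C12 D\<^esub> x"
    using C12_adj_two_step[OF digraph_axioms, of y x w a] w a \<open>w \<noteq> x\<close> \<open>x \<noteq> y\<close> \<open>a \<noteq> y\<close> by blast
  then show ?thesis by (rule C12_adj_sym[OF digraph_axioms])
qed

text \<open>If neither neighborhood is the given singleton, then \<open>x\<close> has an
  out-neighbor \<open>a \<noteq> y\<close> and \<open>y\<close> has an out-neighbor
  \<open>b \<noteq> x\<close>. Now \<open>a\<close> is in \<open>X i\<close> and \<open>b\<close> is
  not, so an arc joins them, and its head witnesses adjacency of \<open>x\<close> and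
  \<open>y\<close>.\<close>

lemma not_C12_adj_F_set_iff:
  assumes "i \<in> {2..k}" "x \<in> F_set D (X i)" "y \<in> X i"
  shows "\<not> x \<rightarrow>\<^bsub>C12 D\<^esub> y \<longleftrightarrow> out_nbrs D x = {y} \<or> out_nbrs D y = {x}"
proof
  assume "out_nbrs D x = {y} \<or> out_nbrs D y = {x}"
  then show "\<not> x \<rightarrow>\<^bsub>C12 D\<^esub> y"
    using not_C12_adj_if_single_out_nbr[OF digraph_axioms] C12_adj_sym[OF digraph_axioms] by blast
next
  assume nadj: "\<not> x \<rightarrow>\<^bsub>C12 D\<^esub> y"
  show "out_nbrs D x = {y} \<or> out_nbrs D y = {x}"
  proof (rule ccontr)
    assume neg: "\<not> (out_nbrs D x = {y} \<or> out_nbrs D y = {x})"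
    have i: "i \<in> {1..k}" using assms(1) by auto
    have "x \<in> X 1" using F_set_subset_X1 assms by blast
    have "y \<in> verts D - X 1"
      using disjoint_parts[of i 1 y] assms by (force simp: verts_eq)
    \<comment> \<open>Since \<open>y\<close> lies outside \<open>X 1\<close> it has an out-neighbor
      there, so failing to equal \<open>{x}\<close> leaves \<open>out_nbrs D y\<close> with a vertex
      other than \<open>x\<close>.\<close>
    then have "x \<noteq> y" "out_nbrs D y \<noteq> {}"
      using \<open>x \<in> X 1\<close> out_nbr_in_X1[of y] by (auto simp: out_nbrs_def)
    have "out_nbrs D x \<noteq> {}" using assms(2) by (simp add: F_set_def)
    then obtain a where a: "x \<rightarrow>\<^bsub>D\<^esub> a" "a \<noteq> y" using neg unfolding out_nbrs_def by blast
    obtain b where b: "y \<rightarrow>\<^bsub>D\<^esub> b" "b \<noteq> x"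
      using \<open>out_nbrs D y \<noteq> {}\<close> neg unfolding out_nbrs_def by blast
    have "a \<in> X i" using a assms(2) by (auto simp: F_set_def out_nbrs_def)
    obtain j where j: "j \<in> {1..k}" "b \<in> X j"
      using adj_in_verts(2)[OF b(1)] by (auto simp: verts_eq)
    have "i \<noteq> j" using adj_not_same_part[OF i assms(3) b(1)] j(2) by blast
    then consider "a \<rightarrow>\<^bsub>D\<^esub> b" | "b \<rightarrow>\<^bsub>D\<^esub> a" using adj_total[OF i j(1) _ \<open>a \<in> X i\<close> j(2)] by blast
    then have "x \<rightarrow>\<^bsub>C12 D\<^esub> y"
    proof cases
      case 1
      then show ?thesis
        using C12_adj_two_step[OF digraph_axioms, of y x b a] \<open>x \<noteq> y\<close> a b
          C12_adj_sym[OF digraph_axioms] by metis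
    next
      case 2
      then show ?thesis
        using C12_adj_two_step[OF digraph_axioms, of x y a b] \<open>x \<noteq> y\<close> a b by blast
    qed
    with nadj show False by blast
  qed
qed

section \<open>When the complement of \<open>X 1\<close> is a clique\<close>

lemma clique_if_sink:
  assumes "sink D s"
  shows "clique (C12 D) (verts D - X 1)"
  unfolding clique_def verts_C12
  \<comment> \<open>The sink is an out-neighbor of every vertex outside \<open>X 1\<close>.\<close>
  using sink_dominated[OF assms] C12_adj_common[OF digraph_axioms] by blast

lemma clique_if_anti_competing_3:
  assumes "S \<subseteq> X 1" "anti_competing12 D S" "card S \<ge> 3"
  shows "clique (C12 D) (verts D - X 1)"
proof -
  obtain T where T: "T \<subseteq> S" "card T = 3" using obtain_subset_with_card_n[OF assms(3)] by metis
  then obtain p q r where pqr: "T = {p, q, r}" "p \<noteq> q" "p \<noteq> r" "q \<noteq> r"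
    by (metis card_3_iff)
  have nadj: "\<not> p \<rightarrow>\<^bsub>C12 D\<^esub> q" "\<not> p \<rightarrow>\<^bsub>C12 D\<^esub> r" "\<not> q \<rightarrow>\<^bsub>C12 D\<^esub> r"
    using assms(2) T(1) pqr(1) by (auto simp: anti_competing12_def stable_set_def)
  have mem: "p \<in> X 1" "q \<in> X 1" "r \<in> X 1" using assms(1) T(1) pqr(1) by auto
  \<comment> \<open>Every vertex outside \<open>X 1\<close> dominates two of \<open>p, q, r\<close>, so any two of them share one.\<close>
  have "u \<rightarrow>\<^bsub>C12 D\<^esub> v" if uv: "u \<in> verts D - X 1" "v \<in> verts D - X 1" "u \<noteq> v" for u v
  proof -
    have two: "(w \<rightarrow>\<^bsub>D\<^esub> p \<or> w \<rightarrow>\<^bsub>D\<^esub> q) \<and> (w \<rightarrow>\<^bsub>D\<^esub> p \<or> w \<rightarrow>\<^bsub>D\<^esub> r) \<and> (w \<rightarrow>\<^bsub>D\<^esub> q \<or> w \<rightarrow>\<^bsub>D\<^esub> r)"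
      if "w \<in> verts D - X 1" for w
      using nonadjacent_dominated[OF _ _ _ _ that] mem pqr(2-4) nadj by blast
    then obtain w where "u \<rightarrow>\<^bsub>D\<^esub> w" "v \<rightarrow>\<^bsub>D\<^esub> w"
      using two[OF uv(1)] two[OF uv(2)] by blast
    then show ?thesis using C12_adj_common[OF digraph_axioms uv(3)] by blast
  qed
  then show ?thesis unfolding clique_def verts_C12 by blast
qed

end

theorem theorem3p3:
  fixes D :: "('a, 'b) pre_digraph" and k :: nat and X :: "nat \<Rightarrow> 'a set"
  assumes "k \<ge> 3"
    and "loose k X D"
    and "\<not> competing12 D (X 1)"
    and "\<And>S v. \<lbrakk>S \<subseteq> X 1; anti_competing12 D S; card {u \<in> S. \<not> sink D u} \<ge> 2;
           v \<in> S; \<not> sink D v\<rbrakk> \<Longrightarrow> out_nbrs D v \<subseteq> X 2"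
  shows "(\<forall>i\<in>{2..k}. F_set D (X i) \<subseteq> X 1)
    \<and> (clique (C12 D) (\<Union>i\<in>{3..k}. X i)
         \<and> (\<forall>x\<in>(\<Union>i\<in>{3..k}. X i). \<forall>y\<in>X 2. x \<rightarrow>\<^bsub>C12 D\<^esub> y))
    \<and> (\<forall>i\<in>{2..k}. \<forall>j\<in>{2..k}. i \<noteq> j \<longrightarrow>
         (\<forall>x\<in>F_set D (X i). \<forall>y\<in>F_set D (X j) \<union> X j. x \<rightarrow>\<^bsub>C12 D\<^esub> y))
    \<and> (\<forall>i\<in>{2..k}. \<forall>x\<in>verts D. \<forall>y\<in>X i. \<not> sink D x \<and> out_nbrs D x \<subseteq> X i \<longrightarrow>
         (\<not> x \<rightarrow>\<^bsub>C12 D\<^esub> y \<longleftrightarrow> out_nbrs D x = {y} \<or> out_nbrs D y = {x}))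
    \<and> ((\<exists>v\<in>verts D. sink D v) \<or> (\<exists>S\<subseteq>X 1. anti_competing12 D S \<and> card S \<ge> 3) \<longrightarrow>
         clique (C12 D) (verts D - X 1))"
proof -
  have pt: "partite_tournament k X D"
    using assms(2) by (simp add: loose_def multipartite_tournament_def)
  then have "digraph D" by (simp add: partite_tournament_def orientation_of_def)
  then interpret digraph D .
  interpret labeled_loose D k X
    using pt assms(1,3,4) by unfold_locales auto
  have part1: "\<forall>i\<in>{2..k}. F_set D (X i) \<subseteq> X 1"
    using F_set_subset_X1 by blast
  have upper: "{3..k} \<subseteq> {2..k}" "{3..k} \<subseteq> {1..k}" "2 \<in> {2..k}" using assms(1) by auto
  have part2a: "clique (C12 D) (\<Union>i\<in>{3..k}. X i)"
    unfolding clique_def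
  proof (intro conjI ballI impI)
    show "(\<Union>i\<in>{3..k}. X i) \<subseteq> verts (with_proj (C12 D))"
      using upper(2) unfolding verts_C12 verts_eq by blast
    fix u v assume "u \<in> (\<Union>i\<in>{3..k}. X i)" "v \<in> (\<Union>i\<in>{3..k}. X i)" "u \<noteq> v"
    \<comment> \<open>Both vertices may lie in the same partite set; \<open>C12_adj_parts\<close>
      covers this because the index is at least three.\<close>
    then show "u \<rightarrow>\<^bsub>C12 D\<^esub> v"
      using C12_adj_parts upper(1) by fastforce
  qed
  have part2b: "\<forall>x\<in>(\<Union>i\<in>{3..k}. X i). \<forall>y\<in>X 2. x \<rightarrow>\<^bsub>C12 D\<^esub> y"
  proof (intro ballI)
    fix x y assume "x \<in> (\<Union>i\<in>{3..k}. X i)" and y: "y \<in> X 2"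
    then obtain i where i: "i \<in> {3..k}" "x \<in> X i" by blast
    then have "x \<noteq> y" using disjoint_parts[of i 2 x] y by force
    then show "x \<rightarrow>\<^bsub>C12 D\<^esub> y"
      using C12_adj_parts[of i 2 x y] i y upper by auto
  qed
  have part3: "\<forall>i\<in>{2..k}. \<forall>j\<in>{2..k}. i \<noteq> j \<longrightarrow>
      (\<forall>x\<in>F_set D (X i). \<forall>y\<in>F_set D (X j) \<union> X j. x \<rightarrow>\<^bsub>C12 D\<^esub> y)"
    using C12_adj_F_set_F_set C12_adj_F_set_part by blast
  have part4: "\<forall>i\<in>{2..k}. \<forall>x\<in>verts D. \<forall>y\<in>X i. \<not> sink D x \<and> out_nbrs D x \<subseteq> X i \<longrightarrow>
      (\<not> x \<rightarrow>\<^bsub>C12 D\<^esub> y \<longleftrightarrow> out_nbrs D x = {y} \<or> out_nbrs D y = {x})"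
  proof (intro ballI impI)
    fix i x y
    assume "i \<in> {2..k}" "x \<in> verts D" "y \<in> X i" "\<not> sink D x \<and> out_nbrs D x \<subseteq> X i"
    \<comment> \<open>Not being a sink means that \<open>out_nbrs D x\<close> is nonempty, so
      \<open>x\<close> belongs to \<open>F_set D (X i)\<close>.\<close>
    then show "\<not> x \<rightarrow>\<^bsub>C12 D\<^esub> y \<longleftrightarrow> out_nbrs D x = {y} \<or> out_nbrs D y = {x}"
      by (intro not_C12_adj_F_set_iff) (auto simp: F_set_def sink_iff)
  qed
  have part5: "(\<exists>v\<in>verts D. sink D v) \<or> (\<exists>S\<subseteq>X 1. anti_competing12 D S \<and> card S \<ge> 3) \<longrightarrow>
      clique (C12 D) (verts D - X 1)"
    using clique_if_sink clique_if_anti_competing_3 by blast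
  show ?thesis
    by (intro conjI part1 part2a part2b part3 part4 part5)
qed

end
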